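(* Let $n\ge 1$ and let $\lambda=(\lambda_1,\ldots,\lambda_r)\vdash n$ be a partition of $n$ with $r$ parts, $\lambda_r\ge 1$. The eigenvalues of the derangement graphs satisfy the recurrence $$\eta_{\lambda}=(-1)^{r-1}\lambda_r\,\eta_{\lambda-\hat c}+(-1)^{\lambda_r}\,\eta_{\lambda-\hat l},$$ with initial condition $\eta_{\emptyset}=1$.
   Context: A partition $\lambda\vdash n$ is a weakly decreasing sequence $\lambda_1\ge\cdots\ge\lambda_r\ge 1$ of positive integers with sum $n$; $\emptyset$ is the empty partition of $0$; whenever an operation produces zero parts, these are discarded. The derangement graph $\Gamma_n$ is the Cayley graph of the symmetric group $\mathcal S_n$ whose connection set is the set $\mathcal D_n$ of derangements (fixed-point-free permutations) of $\{1,\dots,n\}$. Its eigenvalues are indexed by partitions $\lambda\vdash n$ and are $$\eta_\lambda=\frac{1}{\chi_\lambda(1)}\sum_{s\in\mathcal D_n}\chi_\lambda(s),$$ where $\chi_\lambda$ is the irreducible character of $\mathcal S_n$ indexed by $\lambda$ (standard labelling: $(n)$ is the trivial character, $(1^n)$ the sign character). By convention $\eta_\emptyset=1$. For $\lambda=(\lambda_1,\ldots,\lambda_r)$: $\lambda-\hat c=(\lambda_1-1,\ldots,\lambda_r-1)\vdash n-r$ is obtained by deleting the first column of the Young diagram (zero parts discarded), and $\lambda-\hat l=(\lambda_1,\ldots,\lambda_{r-1})\vdash n-\lambda_r$ is obtained by deleting the last row. *)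

theory Defs
  imports
    Complex_Main
    "HOL-Combinatorics.Permutations"
    "HOL-Library.Function_Algebras"
begin

section \<open>Partitions and Young diagrams\<close>

definition partition_of :: "nat list \<Rightarrow> nat \<Rightarrow> bool" where
  "partition_of lam n \<longleftrightarrow> sorted_wrt (\<ge>) lam \<and> (\<forall>x\<in>set lam. 1 \<le> x) \<and> sum_list lam = n"

definition remove_column :: "nat list \<Rightarrow> nat list" where
  "remove_column lam = filter (\<lambda>x. x \<noteq> 0) (map (\<lambda>x. x - 1) lam)"

definition remove_row :: "nat list \<Rightarrow> nat list" where
  "remove_row lam = butlast lam"

text \<open>Cells are indexed from 0: cell \<open>(i, j)\<close> lies in row \<open>i\<close> and column \<open>j\<close>.\<close>

definition diagram :: "nat list \<Rightarrow> (nat \<times> nat) set" where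
  "diagram lam = {(i, j). i < length lam \<and> j < lam ! i}"

section \<open>Specht modules\<close>

definition tableau :: "nat list \<Rightarrow> (nat \<times> nat \<Rightarrow> nat) \<Rightarrow> bool" where
  "tableau lam t \<longleftrightarrow> bij_betw t (diagram lam) {1..sum_list lam}"

text \<open>
  The row-equivalence class of a tableau is determined by its sequence of rows, each viewed
  as an unordered set of entries; this sequence represents the tabloid.
\<close>

type_synonym tabloid = "nat set list"

definition tabloid_of :: "nat list \<Rightarrow> (nat \<times> nat \<Rightarrow> nat) \<Rightarrow> tabloid" where
  "tabloid_of lam t = map (\<lambda>i. {t (i, j) |j. j < lam ! i}) [0..<length lam]"

definition column_stabilizer :: "nat list \<Rightarrow> (nat \<times> nat \<Rightarrow> nat) \<Rightarrow> (nat \<Rightarrow> nat) set" where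
  "column_stabilizer lam t =
     {p. p permutes {1..sum_list lam} \<and>
         (\<forall>j. p ` {t (i, j) |i. (i, j) \<in> diagram lam} = {t (i, j) |i. (i, j) \<in> diagram lam})}"

text \<open>
  Formal complex combinations of tabloids are coefficient functions
  \<open>tabloid \<Rightarrow> complex\<close>, a complex vector space under the pointwise operations.
\<close>

definition fscale :: "complex \<Rightarrow> ('a \<Rightarrow> complex) \<Rightarrow> 'a \<Rightarrow> complex" where
  "fscale c f = (\<lambda>x. c * f x)"

global_interpretation cfun: vector_space fscale
  by unfold_locales (auto simp: fscale_def fun_eq_iff algebra_simps)

definition polytabloid :: "nat list \<Rightarrow> (nat \<times> nat \<Rightarrow> nat) \<Rightarrow> tabloid \<Rightarrow> complex" where
  "polytabloid lam t =
     (\<lambda>T. \<Sum>p\<in>column_stabilizer lam t. of_int (sign p) * of_bool (T = tabloid_of lam (p \<circ> t)))"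

definition specht :: "nat list \<Rightarrow> (tabloid \<Rightarrow> complex) set" where
  "specht lam = cfun.span {polytabloid lam t |t. tableau lam t}"

text \<open>
  The linear extension of \<open>T \<mapsto> s T\<close>, where \<open>s\<close> acts on a tabloid by acting on its entries;
  on coefficient functions this is precomposition with the inverse of \<open>s\<close>.
\<close>

definition perm_act :: "(nat \<Rightarrow> nat) \<Rightarrow> (tabloid \<Rightarrow> complex) \<Rightarrow> tabloid \<Rightarrow> complex" where
  "perm_act s f = (\<lambda>T. f (map (\<lambda>R. inv s ` R) T))"

section \<open>Irreducible characters and eigenvalues\<close>

text \<open>
  The trace of an endomorphism of a finite-dimensional subspace \<open>V\<close>; the choice of the
  basis \<open>B\<close> is immaterial.
\<close>

definition trace_on :: "('a \<Rightarrow> complex) set \<Rightarrow> (('a \<Rightarrow> complex) \<Rightarrow> ('a \<Rightarrow> complex)) \<Rightarrow> complex" where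
  "trace_on V F =
     (let B = (SOME B. cfun.independent B \<and> cfun.span B = V)
      in \<Sum>b\<in>B. cfun.representation B (F b) b)"

text \<open>
  The Specht modules over the complex numbers form a complete set of irreducible
  representations of the symmetric group, and this labelling is the standard one:
  \<open>(n)\<close> gives the trivial and \<open>(1\<^sup>n)\<close> the sign character.
\<close>

definition irr_char :: "nat list \<Rightarrow> (nat \<Rightarrow> nat) \<Rightarrow> complex" where
  "irr_char lam s = trace_on (specht lam) (perm_act s)"

definition derangements :: "nat \<Rightarrow> (nat \<Rightarrow> nat) set" where
  "derangements n = {s. s permutes {1..n} \<and> (\<forall>i\<in>{1..n}. s i \<noteq> i)}"

text \<open>
  The eigenvalue of the derangement graph on \<open>n\<close> points, \<open>n\<close> being the size of \<open>lam\<close>. For the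
  empty partition the formula below already yields the conventional value 1: the identity is
  the only permutation of the empty set and it is a derangement.
\<close>

definition derangement_eigenvalue :: "nat list \<Rightarrow> complex" where
  "derangement_eigenvalue lam =
     1 / irr_char lam id * (\<Sum>s\<in>derangements (sum_list lam). irr_char lam s)"

end

theory Submission
  imports Defs
begin

text \<open>
  The sum \<open>z\<close> of all derangements is central, so it maps a polytabloid \<open>\<kappa>\<^sub>t{t}\<close> to \<open>\<kappa>\<^sub>tz{t}\<close>,
  which is again a multiple of \<open>\<kappa>\<^sub>t{t}\<close> since \<open>\<kappa>\<^sub>t{u}\<close> is one for every tableau \<open>u\<close>. Hence \<open>z\<close> acts
  on the Specht module as a scalar, which is \<open>\<eta>\<^sub>\<lambda>\<close>. Reading off the coefficient of \<open>{t}\<close> gives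
  \<open>\<eta>\<^sub>\<lambda> = \<Sum> sgn p\<close> over pairs of a column permutation \<open>p\<close> and a row permutation \<open>g\<close> with
  \<open>p\<inverse>g\<close> a derangement. As \<open>g x = p x\<close> forces \<open>g x = x = p x\<close>, this means that \<open>p\<close> and \<open>g\<close> have no
  common fixed point. Inclusion-exclusion over the common fixed points leaves, because signed sums
  of column permutations cancel, \<open>(-1)\<^sup>n \<Sum>\<^sub>T (-1)\<^bsup>|T|\<^esup> \<Prod>\<^sub>i |T\<^sub>i|!\<close> over the sets \<open>T\<close> of cells with at most
  one cell in each column, \<open>T\<^sub>i\<close> being the part of \<open>T\<close> in row \<open>i\<close>. Choosing the \<open>k\<close> cells of \<open>T\<close> in
  the last row deletes \<open>k\<close> columns from the other rows, and in the resulting sum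
  \<open>k (m choose k) = m (m-1 choose k-1)\<close> yields the recurrence.
\<close>

section \<open>Permutations preserving the fibres of a map\<close>

text \<open>For the row or column function of a tableau this is its row or column group. An
  arbitrary ground set is allowed because inclusion-exclusion passes to subsets of the
  entries.\<close>

definition fibre_perms :: "('a \<Rightarrow> 'b) \<Rightarrow> 'a set \<Rightarrow> ('a \<Rightarrow> 'a) set" where
  "fibre_perms f X = {p. p permutes X \<and> (\<forall>x\<in>X. f (p x) = f x)}"

lemma finite_fibre_perms: "finite X \<Longrightarrow> finite (fibre_perms f X)"
  unfolding fibre_perms_def by (rule finite_subset[OF _ finite_permutations[of X]]) auto

text \<open>Prescribing fixed points only shrinks the ground set, so the sums met in
  inclusion-exclusion stay of the same kind.\<close>

lemma fibre_perms_fixing: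
  assumes "S \<subseteq> X"
  shows "{p \<in> fibre_perms f X. \<forall>x\<in>S. p x = x} = fibre_perms f (X - S)"
proof (intro set_eqI iffI)
  fix p assume "p \<in> {p \<in> fibre_perms f X. \<forall>x\<in>S. p x = x}"
  then show "p \<in> fibre_perms f (X - S)"
    by (auto simp: fibre_perms_def intro: permutes_superset)
next
  fix p assume "p \<in> fibre_perms f (X - S)"
  then have p: "p permutes X - S" "\<forall>x\<in>X - S. f (p x) = f x"
    by (auto simp: fibre_perms_def)
  have "\<forall>x\<in>S. p x = x" using p(1) by (auto simp: permutes_def)
  moreover have "p permutes X" using p(1) by (rule permutes_subset) auto
  ultimately show "p \<in> {p \<in> fibre_perms f X. \<forall>x\<in>S. p x = x}"
    using p(2) by (auto simp: fibre_perms_def)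
qed

lemma fibre_perms_comp:
  assumes "p \<in> fibre_perms f X" "q \<in> fibre_perms f X"
  shows "p \<circ> q \<in> fibre_perms f X"
  using assms by (auto simp: fibre_perms_def permutes_in_image intro: permutes_compose)

lemma fibre_perms_inv:
  assumes "p \<in> fibre_perms f X"
  shows "inv p \<in> fibre_perms f X"
proof -
  have p: "p permutes X" and f: "\<And>x. x \<in> X \<Longrightarrow> f (p x) = f x"
    using assms by (auto simp: fibre_perms_def)
  have "f (inv p x) = f x" if "x \<in> X" for x
    using f[of "inv p x"] that permutes_in_image[OF permutes_inv[OF p]]
    by (simp add: permutes_inverses(1)[OF p])
  then show ?thesis using p by (simp add: fibre_perms_def permutes_inv)
qed

lemma fibre_perms_transpose:
  assumes "x \<in> X" "y \<in> X" "f x = f y"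
  shows "transpose x y \<in> fibre_perms f X"
  using assms by (auto simp: fibre_perms_def transpose_def intro: permutes_swap_id)

lemma sign_comp_transpose:
  assumes "finite X" "p permutes X" "x \<noteq> y"
  shows "sign (p \<circ> transpose x y) = - sign p"
  using assms by (simp add: sign_compose permutation_swap_id permutes_imp_permutation sign_swap_id)

text \<open>The map \<open>p \<mapsto> p \<circ> transpose x y\<close> is an involution of the
  group, since \<open>x\<close> and \<open>y\<close> share a fibre. It reverses the sign and keeps
  the weight, so the sum equals its own negative.\<close>

lemma sum_sign_eq_0:
  fixes w :: "('a \<Rightarrow> 'a) \<Rightarrow> 'b :: {idom, ring_char_0}"
  assumes X: "finite X" and xy: "x \<in> X" "y \<in> X" "x \<noteq> y" "f x = f y"
    and w: "\<And>p. p \<in> fibre_perms f X \<Longrightarrow> w (p \<circ> transpose x y) = w p"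
  shows "(\<Sum>p\<in>fibre_perms f X. of_int (sign p) * w p) = 0"
proof -
  let ?S = "\<Sum>p\<in>fibre_perms f X. of_int (sign p) * w p"
  have "?S = (\<Sum>p\<in>fibre_perms f X. of_int (sign (p \<circ> transpose x y)) * w (p \<circ> transpose x y))"
    by (rule sum.reindex_bij_witness[where i = "\<lambda>p. p \<circ> transpose x y" and j = "\<lambda>p. p \<circ> transpose x y"])
      (auto simp: comp_assoc intro: fibre_perms_comp fibre_perms_transpose xy)
  also have "\<dots> = (\<Sum>p\<in>fibre_perms f X. - (of_int (sign p) * w p))"
  proof (rule sum.cong[OF refl])
    fix p assume p: "p \<in> fibre_perms f X"
    then have "sign (p \<circ> transpose x y) = - sign p"
      using sign_comp_transpose[OF X _ xy(3)] by (auto simp: fibre_perms_def)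
    then show "of_int (sign (p \<circ> transpose x y)) * w (p \<circ> transpose x y) = - (of_int (sign p) * w p)"
      using w[OF p] by simp
  qed
  also have "\<dots> = - ?S" by (simp add: sum_negf)
  finally have "2 * ?S = 0" by simp
  then show ?thesis by simp
qed

lemma fibre_perms_inj_on:
  assumes "inj_on f X"
  shows "fibre_perms f X = {id}"
proof -
  have "p = id" if "p permutes X" "\<forall>x\<in>X. f (p x) = f x" for p
  proof
    fix x show "p x = id x"
      using that assms by (cases "x \<in> X") (auto simp: inj_on_def permutes_in_image permutes_not_in)
  qed
  then show ?thesis by (auto simp: fibre_perms_def)
qed

text \<open>Two points in one fibre make the signs cancel; if there are none, the identity is the
  only permutation.\<close>

lemma sum_sign_fibre_perms:
  assumes "finite X"
  shows "(\<Sum>p\<in>fibre_perms f X. sign p) = of_bool (inj_on f X)"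
proof (cases "inj_on f X")
  case True
  then show ?thesis by (simp add: fibre_perms_inj_on)
next
  case False
  then obtain x y where "x \<in> X" "y \<in> X" "x \<noteq> y" "f x = f y" by (auto simp: inj_on_def)
  from sum_sign_eq_0[OF assms this, of "\<lambda>_. 1 :: int"] show ?thesis using False by simp
qed

section \<open>Pairs of row and column permutations without common fixed point\<close>

text \<open>Expand the product of the factors \<open>1 - of_bool (Q x)\<close> over all subsets. In
  the application \<open>Q x\<close> says that both permutations fix \<open>x\<close>.\<close>

lemma fixpoint_free_alternating_sum:
  assumes "finite X"
  shows "(of_bool (\<forall>x\<in>X. \<not> Q x) :: int) = (\<Sum>S\<in>Pow X. (-1) ^ card S * of_bool (\<forall>x\<in>S. Q x))"
proof -
  have *: "(\<Prod>x\<in>A. of_bool (Q x) :: int) = of_bool (\<forall>x\<in>A. Q x)" if "finite A" for A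
    using that by induction auto
  have **: "(\<Prod>x\<in>A. 1 - of_bool (Q x) :: int) = of_bool (\<forall>x\<in>A. \<not> Q x)" if "finite A" for A
    using that by induction auto
  have "(\<Prod>x\<in>X. 1 - of_bool (Q x) :: int) = (\<Prod>x\<in>X. - of_bool (Q x) + 1)"
    by simp
  also have "\<dots> = (\<Sum>S\<in>Pow X. (\<Prod>x\<in>S. - of_bool (Q x)) * (\<Prod>x\<in>X - S. 1))"
    by (rule prod_add[OF assms])
  also have "\<dots> = (\<Sum>S\<in>Pow X. (-1) ^ card S * of_bool (\<forall>x\<in>S. Q x))"
    using assms by (intro sum.cong refl) (simp add: * finite_subset prod_uminus)
  finally show ?thesis using **[OF assms] by simp
qed

text \<open>The sets \<open>T\<close> are the partial transversals of the columns; the cardinality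
  of \<open>fibre_perms row T\<close> is the product of the factorials of the row sizes of
  \<open>T\<close>.\<close>

definition transversal_sum :: "('a \<Rightarrow> 'r) \<Rightarrow> ('a \<Rightarrow> 'c) \<Rightarrow> 'a set \<Rightarrow> int" where
  "transversal_sum row col X =
     (\<Sum>T | T \<subseteq> X \<and> inj_on col T. (-1) ^ card T * int (card (fibre_perms row T)))"

text \<open>For a prescribed set \<open>S\<close> of common fixed points the double sum factors into
  a signed column part and a row count. The column part vanishes unless \<open>X - S\<close> has at
  most one point in each column.\<close>

lemma signed_sum_no_common_fixpoint:
  assumes X: "finite X"
  shows "(\<Sum>p\<in>fibre_perms col X. \<Sum>g\<in>fibre_perms row X.
             sign p * of_bool (\<forall>x\<in>X. \<not> (p x = x \<and> g x = x)))
         = (-1) ^ card X * transversal_sum row col X"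
proof -
  let ?C = "fibre_perms col X" and ?R = "fibre_perms row X"
  have fin: "finite ?C" "finite ?R" using X by (auto intro: finite_fibre_perms)
  have "(\<Sum>p\<in>?C. \<Sum>g\<in>?R. sign p * of_bool (\<forall>x\<in>X. \<not> (p x = x \<and> g x = x)))
      = (\<Sum>p\<in>?C. \<Sum>g\<in>?R. \<Sum>S\<in>Pow X. (-1) ^ card S *
            ((sign p * of_bool (\<forall>x\<in>S. p x = x)) * of_bool (\<forall>x\<in>S. g x = x)))"
    by (intro sum.cong refl, subst fixpoint_free_alternating_sum[OF X])
      (simp add: sum_distrib_left ball_conj_distrib of_bool_conj mult_ac)
  also have "\<dots> = (\<Sum>S\<in>Pow X. \<Sum>p\<in>?C. \<Sum>g\<in>?R. (-1) ^ card S *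
            ((sign p * of_bool (\<forall>x\<in>S. p x = x)) * of_bool (\<forall>x\<in>S. g x = x)))"
    by (subst sum.swap[of _ "Pow X"]) (intro sum.cong refl sum.swap)
  also have "\<dots> = (\<Sum>S\<in>Pow X. (-1) ^ card S *
       ((\<Sum>p\<in>?C. sign p * of_bool (\<forall>x\<in>S. p x = x)) * (\<Sum>g\<in>?R. of_bool (\<forall>x\<in>S. g x = x))))"
    by (simp only: sum_product) (simp only: sum_distrib_left)
  also have "\<dots> = (\<Sum>S\<in>Pow X. (-1) ^ card S *
       (of_bool (inj_on col (X - S)) * int (card (fibre_perms row (X - S)))))"
  proof (rule sum.cong[OF refl])
    fix S assume "S \<in> Pow X"
    then have S: "S \<subseteq> X" by simp
    have "(\<Sum>p\<in>?C. sign p * of_bool (\<forall>x\<in>S. p x = x)) = (\<Sum>p\<in>fibre_perms col (X - S). sign p)"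
      using fin by (simp add: fibre_perms_fixing[OF S, symmetric] sum.inter_filter of_bool_def if_distrib cong: if_cong)
    moreover have "(\<Sum>g\<in>?R. of_bool (\<forall>x\<in>S. g x = x)) = int (card (fibre_perms row (X - S)))"
      using fin by (simp add: fibre_perms_fixing[OF S, symmetric] Int_def)
    ultimately show "(-1) ^ card S * ((\<Sum>p\<in>?C. sign p * of_bool (\<forall>x\<in>S. p x = x)) * (\<Sum>g\<in>?R. of_bool (\<forall>x\<in>S. g x = x)))
      = (-1) ^ card S * (of_bool (inj_on col (X - S)) * int (card (fibre_perms row (X - S))))"
      using X by (simp add: sum_sign_fibre_perms)
  qed
  also have "\<dots> = (\<Sum>T\<in>Pow X. (-1) ^ card X * ((-1) ^ card T *
       (of_bool (inj_on col T) * int (card (fibre_perms row T)))))"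
  \<comment> \<open>Passing to the complement \<open>T = X - S\<close> turns the sign of
    \<open>S\<close> into that of \<open>T\<close> times the global factor
    \<open>(-1) ^ card X\<close>.\<close>
  proof (rule sum.reindex_bij_witness[where i = "\<lambda>T. X - T" and j = "\<lambda>T. X - T"])
    fix S assume "S \<in> Pow X"
    then have S: "S \<subseteq> X" by simp
    then have "card X = card S + card (X - S)"
      using X by (metis card_Diff_subset card_mono finite_subset le_add_diff_inverse)
    then show "(-1) ^ card X * ((-1) ^ card (X - S) *
         (of_bool (inj_on col (X - S)) * int (card (fibre_perms row (X - S)))))
      = (-1) ^ card S * (of_bool (inj_on col (X - S)) * int (card (fibre_perms row (X - S))))"
      by (simp add: power_add)
  qed auto
  also have "\<dots> = (-1) ^ card X *
      (\<Sum>T\<in>Pow X. if inj_on col T then (-1) ^ card T * int (card (fibre_perms row T)) else 0)"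
    by (simp only: sum_distrib_left) (intro sum.cong refl, simp)
  also have "\<dots> = (-1) ^ card X * transversal_sum row col X"
    using X by (simp add: sum.inter_filter[symmetric] transversal_sum_def)
  finally show ?thesis .
qed

section \<open>Evaluation of the transversal sum row by row\<close>

lemma card_fibre_perms_Un:
  assumes fin: "finite A" "finite B" and dis: "\<And>a b. a \<in> A \<Longrightarrow> b \<in> B \<Longrightarrow> f a \<noteq> f b"
  shows "card (fibre_perms f (A \<union> B)) = card (fibre_perms f A) * card (fibre_perms f B)"
proof -
  have AB: "A \<inter> B = {}" using dis by blast
  have "bij_betw (\<lambda>(g, h). g \<circ> h) (fibre_perms f A \<times> fibre_perms f B) (fibre_perms f (A \<union> B))"
  proof (rule bij_betw_byWitness[where f' = "\<lambda>p. (restrict_id p A, restrict_id p B)"])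
    show "\<forall>gh\<in>fibre_perms f A \<times> fibre_perms f B.
       (\<lambda>p. (restrict_id p A, restrict_id p B)) ((\<lambda>(g, h). g \<circ> h) gh) = gh"
      using AB
      by (auto simp: fibre_perms_def restrict_id_def fun_eq_iff permutes_not_in permutes_in_image)
        (metis disjoint_iff permutes_not_in permutes_in_image)+
    \<comment> \<open>No fibre meets both parts, so \<open>p\<close> maps each part into itself, and
      onto itself by finiteness. Hence \<open>p\<close> is recovered from its two
      restrictions.\<close>
    have p: "bij_betw p A A" "bij_betw p B B" if "p \<in> fibre_perms f (A \<union> B)" for p
    proof -
      have pp: "p permutes A \<union> B" and "\<forall>x\<in>A \<union> B. f (p x) = f x"
        using that by (auto simp: fibre_perms_def)
      then have "p ` A \<subseteq> A" "p ` B \<subseteq> B" using dis permutes_in_image[OF pp] by force+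
      then show "bij_betw p A A" "bij_betw p B B"
        using fin permutes_inj_on[OF pp] by (simp_all add: bij_betw_def endo_inj_surj)
    qed
    show "\<forall>p\<in>fibre_perms f (A \<union> B). (\<lambda>(g, h). g \<circ> h) (restrict_id p A, restrict_id p B) = p"
    proof (intro ballI ext)
      fix p x assume "p \<in> fibre_perms f (A \<union> B)"
      then have "p permutes A \<union> B" "p ` A = A" "p ` B = B"
        using p[of p] by (auto simp: fibre_perms_def bij_betw_def)
      then show "(\<lambda>(g, h). g \<circ> h) (restrict_id p A, restrict_id p B) x = p x"
        using AB by (auto simp: restrict_id_def permutes_not_in)
    qed
    show "(\<lambda>(g, h). g \<circ> h) ` (fibre_perms f A \<times> fibre_perms f B) \<subseteq> fibre_perms f (A \<union> B)"
    proof clarsimp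
      fix g h assume "g \<in> fibre_perms f A" "h \<in> fibre_perms f B"
      then have g: "g permutes A" "\<forall>x\<in>A. f (g x) = f x" and h: "h permutes B" "\<forall>x\<in>B. f (h x) = f x"
        by (auto simp: fibre_perms_def)
      have "g \<circ> h permutes A \<union> B"
        using g h by (intro permutes_compose) (auto intro: permutes_subset)
      moreover have "f (g (h x)) = f x" if "x \<in> A \<union> B" for x
        using that g h AB permutes_not_in[OF g(1)] permutes_not_in[OF h(1)] permutes_in_image[OF h(1)]
        by (metis Un_iff disjoint_iff)
      ultimately show "g \<circ> h \<in> fibre_perms f (A \<union> B)"
        by (auto simp: fibre_perms_def)
    qed
    show "(\<lambda>p. (restrict_id p A, restrict_id p B)) ` fibre_perms f (A \<union> B)
       \<subseteq> fibre_perms f A \<times> fibre_perms f B"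
    proof clarsimp
      fix p assume "p \<in> fibre_perms f (A \<union> B)"
      then show "restrict_id p A \<in> fibre_perms f A \<and> restrict_id p B \<in> fibre_perms f B"
        using p[of p] by (auto simp: fibre_perms_def permutes_restrict_id)
    qed
  qed
  from bij_betw_same_card[OF this] show ?thesis by (simp add: card_cartesian_product)
qed

lemma sum_Pow_card:
  fixes g :: "nat \<Rightarrow> 'b :: comm_semiring_1"
  assumes "finite A"
  shows "(\<Sum>B\<in>Pow A. g (card B)) = (\<Sum>k\<le>card A. of_nat (card A choose k) * g k)"
proof -
  have "(\<Sum>B\<in>Pow A. g (card B)) = (\<Sum>k\<le>card A. \<Sum>B | B \<in> Pow A \<and> card B = k. g (card B))"
    using assms by (intro sum.group[symmetric]) (auto intro: card_mono)
  also have "\<dots> = (\<Sum>k\<le>card A. of_nat (card A choose k) * g k)"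
    using n_subsets[OF assms] by (intro sum.cong) (simp_all add: Pow_def)
  finally show ?thesis .
qed

text \<open>Here \<open>k\<close> counts the transversal cells in the last row \<open>r\<close>:
  there are \<open>a r choose k\<close> ways to choose them, they contribute \<open>fact k\<close>
  row permutations, and their columns are lost to every row above.\<close>

primrec row_recursion :: "nat \<Rightarrow> (nat \<Rightarrow> nat) \<Rightarrow> int" where
  "row_recursion 0 a = 1"
| "row_recursion (Suc r) a =
     (\<Sum>k\<le>a r. int (a r choose k) * (-1) ^ k * fact k * row_recursion r (\<lambda>i. a i - k))"

lemma row_recursion_cong: "(\<And>i. i < r \<Longrightarrow> a i = b i) \<Longrightarrow> row_recursion r a = row_recursion r b"
proof (induction r arbitrary: a b)
  case (Suc r)
  have "row_recursion r (\<lambda>i. a i - k) = row_recursion r (\<lambda>i. b i - k)" for k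
    by (rule Suc.IH) (simp add: Suc.prems)
  then show ?case using Suc.prems[of r] by simp
qed simp

text \<open>The summand with \<open>k = 0\<close> is the recursion without the last row. In the
  others the absorption identity for binomials pulls out the factor \<open>a r\<close>, and what
  remains is the recursion with every row shortened by one cell.\<close>

lemma row_recursion_column_row:
  "row_recursion (Suc r) a = row_recursion r a - int (a r) * row_recursion (Suc r) (\<lambda>i. a i - 1)"
proof (cases "a r")
  case (Suc m)
  let ?G = "\<lambda>k. row_recursion r (\<lambda>i. a i - k)"
  have "int (Suc m choose Suc k) * (-1) ^ Suc k * fact (Suc k) * ?G (Suc k)
      = - int (Suc m) * (int (m choose k) * (-1) ^ k * fact k * ?G (Suc k))" for k
  proof -
    have "int (Suc k) * int (Suc m choose Suc k) = int (Suc m) * int (m choose k)"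
      by (metis Suc_times_binomial of_nat_mult)
    then show ?thesis
      by (simp only: fact_Suc power_Suc) (simp only: of_nat_mult algebra_simps)
  qed
  then have "row_recursion (Suc r) a = ?G 0
      + (\<Sum>k\<le>m. - int (Suc m) * (int (m choose k) * (-1) ^ k * fact k * ?G (Suc k)))"
    using Suc by (simp only: row_recursion.simps sum.atMost_Suc_shift) simp
  also have "\<dots> = ?G 0 - int (Suc m) * (\<Sum>k\<le>m. int (m choose k) * (-1) ^ k * fact k * ?G (Suc k))"
    by (simp only: sum_distrib_left[symmetric])
  \<comment> \<open>Truncated subtraction does no harm here, because
    \<open>a i - 1 - k = a i - Suc k\<close> always holds.\<close>
  also have "(\<Sum>k\<le>m. int (m choose k) * (-1) ^ k * fact k * ?G (Suc k)) = row_recursion (Suc r) (\<lambda>i. a i - 1)"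
    using Suc by simp
  finally show ?thesis using Suc by simp
qed simp


text \<open>Split \<open>T\<close> into its part \<open>B\<close> in the last row and the rest. The
  rest is a transversal of the upper rows that avoids the columns of \<open>B\<close>.\<close>

lemma transversal_sum_peel_row:
  fixes row :: "'a \<Rightarrow> nat"
  assumes X: "finite X" and row: "row ` X \<subseteq> {..<Suc r}"
    and inj: "inj_on (\<lambda>x. (row x, col x)) X"
  shows "transversal_sum row col X =
    (\<Sum>B | B \<subseteq> {x \<in> X. row x = r}. (-1) ^ card B * fact (card B) *
        transversal_sum row col {x \<in> X. row x < r \<and> col x \<notin> col ` B})"
proof -
  define L where "L = {x \<in> X. row x = r}"
  define Y where "Y = (\<lambda>B. {x \<in> X. row x < r \<and> col x \<notin> col ` B})"
  let ?w = "\<lambda>T. (-1) ^ card T * int (card (fibre_perms row T))"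
  have LX: "L \<subseteq> X" and YX: "\<And>B. Y B \<subseteq> X" by (auto simp: L_def Y_def)
  have fin: "finite L" "\<And>B. finite (Y B)"
    using LX YX X finite_subset by blast+
  \<comment> \<open>\<open>B\<close> and \<open>T\<close> occupy different rows, so the row
    permutations multiply, and on the single row of \<open>B\<close> every permutation is
    allowed.\<close>
  have w: "?w (T \<union> B) = (-1) ^ card B * fact (card B) * ?w T" if "B \<subseteq> L" "T \<subseteq> Y B" for B T
  proof -
    have f: "finite B" "finite T" using that fin finite_subset by blast+
    have "fibre_perms row B = {p. p permutes B}"
    proof -
      have "\<forall>x\<in>B. row x = r" using that by (auto simp: L_def)
      then show ?thesis by (auto simp: fibre_perms_def permutes_in_image)
    qed
    then have "card (fibre_perms row B) = fact (card B)"
      using f by (simp add: card_permutations)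
    moreover have "card (fibre_perms row (T \<union> B)) = card (fibre_perms row T) * card (fibre_perms row B)"
      using that f by (intro card_fibre_perms_Un) (fastforce simp: L_def Y_def)+
    moreover have "card (T \<union> B) = card T + card B"
      using that f by (intro card_Un_disjoint) (auto simp: L_def Y_def)
    ultimately show ?thesis by (simp add: power_add)
  qed
  have "transversal_sum row col X
     = (\<Sum>(B, T)\<in>Sigma (Pow L) (\<lambda>B. {T. T \<subseteq> Y B \<and> inj_on col T}).
          (-1) ^ card B * fact (card B) * ?w T)"
    unfolding transversal_sum_def
  proof (rule sum.reindex_bij_witness[where j = "\<lambda>T. (T \<inter> L, T - L)" and i = "\<lambda>(B, T). T \<union> B"], goal_cases)
    case (2 T)
    then have "x \<in> Y (T \<inter> L)" if "x \<in> T" "x \<notin> L" for x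
      using that row by (force simp: L_def Y_def inj_on_def less_Suc_eq)
    with 2 show ?case by (auto intro: inj_on_subset)
  next
    case (4 BT)
    obtain B T where BT: "BT = (B, T)" by force
    with 4 have B: "B \<subseteq> L" and T: "T \<subseteq> Y B" "inj_on col T" by auto
    \<comment> \<open>Cells of one row lie in different columns, so every subset of the last row may
      occur as \<open>B\<close>.\<close>
    have "inj_on col L" using inj by (auto simp: inj_on_def L_def)
    then have "inj_on col B" using B inj_on_subset by blast
    then have "inj_on col (T \<union> B)" using T by (auto simp: inj_on_Un Y_def)
    then show ?case using B T LX YX[of B] BT by auto
  next
    case (5 T)
    then have "x \<in> Y (T \<inter> L)" if "x \<in> T" "x \<notin> L" for x
      using that row by (force simp: L_def Y_def inj_on_def less_Suc_eq)
    then have "?w (T - L \<union> T \<inter> L) = (-1) ^ card (T \<inter> L) * fact (card (T \<inter> L)) * ?w (T - L)"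
      by (intro w) auto
    moreover have "T - L \<union> T \<inter> L = T" by auto
    ultimately show ?case by simp
  qed (auto simp: L_def Y_def)
  also have "\<dots> = (\<Sum>B\<in>Pow L. \<Sum>T | T \<subseteq> Y B \<and> inj_on col T. (-1) ^ card B * fact (card B) * ?w T)"
    using fin by (intro sum.Sigma[symmetric]) auto
  finally show ?thesis
    by (simp add: transversal_sum_def sum_distrib_left Pow_def L_def Y_def)
qed

text \<open>The last hypothesis says that columns have no gaps above a cell, as in a Young diagram.
  Then each column removed with \<open>B\<close> costs every upper row exactly one cell, so only the
  row lengths matter.\<close>

lemma transversal_sum_eq_row_recursion:
  fixes row :: "'a \<Rightarrow> nat"
  assumes "finite X" "row ` X \<subseteq> {..<r}" "inj_on (\<lambda>x. (row x, col x)) X"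
    and "\<And>i x. x \<in> X \<Longrightarrow> i < row x \<Longrightarrow> \<exists>y\<in>X. row y = i \<and> col y = col x"
  shows "transversal_sum row col X = row_recursion r (\<lambda>i. card {x \<in> X. row x = i})"
  using assms
proof (induction r arbitrary: X)
  case 0
  then have "{T. T \<subseteq> X \<and> inj_on col T} = {{}}" by auto
  then show ?case by (simp add: transversal_sum_def fibre_perms_def)
next
  case (Suc r)
  define L where "L = {x \<in> X. row x = r}"
  define Y where "Y = (\<lambda>B. {x \<in> X. row x < r \<and> col x \<notin> col ` B})"
  note X = Suc.prems
  let ?a = "\<lambda>i. card {x \<in> X. row x = i}"
  have "finite L" using X(1) by (simp add: L_def)
  have Y: "transversal_sum row col (Y B) = row_recursion r (\<lambda>i. ?a i - card B)" if B: "B \<subseteq> L" for B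
  proof -
    have "transversal_sum row col (Y B) = row_recursion r (\<lambda>i. card {x \<in> Y B. row x = i})"
    proof (rule Suc.IH)
      show "finite (Y B)" "row ` Y B \<subseteq> {..<r}" using X(1) by (auto simp: Y_def)
      show "inj_on (\<lambda>x. (row x, col x)) (Y B)"
        using X(3) by (rule inj_on_subset) (auto simp: Y_def)
      \<comment> \<open>Whole columns are removed, so the cells above a surviving cell survive
        too.\<close>
      show "\<exists>y\<in>Y B. row y = i \<and> col y = col x" if x: "x \<in> Y B" "i < row x" for i x
      proof -
        from x obtain y where "y \<in> X" "row y = i" "col y = col x"
          using X(4)[of x i] by (auto simp: Y_def)
        with x show ?thesis by (intro bexI[of _ y]) (auto simp: Y_def)
      qed
    qed
    also have "\<dots> = row_recursion r (\<lambda>i. ?a i - card B)"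
    proof (rule row_recursion_cong)
      fix i assume i: "i < r"
      let ?Z = "{x \<in> X. row x = i \<and> col x \<in> col ` B}"
      have inj: "inj_on col {x \<in> X. row x = j}" for j
        using X(3) by (auto simp: inj_on_def)
      \<comment> \<open>Every column of \<open>B\<close> starts in row \<open>r\<close> and
        therefore reaches row \<open>i\<close> above it.\<close>
      have "col ` B \<subseteq> col ` ?Z"
        using X(4) i B by (force simp: L_def image_iff)
      then have "col ` ?Z = col ` B" by auto
      moreover have "inj_on col ?Z" "inj_on col B"
        using inj[of i] inj[of r] B by (auto intro: inj_on_subset simp: L_def)
      ultimately have Z: "card ?Z = card B" by (metis card_image)
      have "{x \<in> Y B. row x = i} = {x \<in> X. row x = i} - ?Z"
        using i by (auto simp: Y_def)
      then show "card {x \<in> Y B. row x = i} = ?a i - card B"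
        using X(1) by (simp add: Z[symmetric] card_Diff_subset subset_iff)
    qed
    finally show ?thesis .
  qed
  have "transversal_sum row col X
      = (\<Sum>B\<in>Pow L. (-1) ^ card B * fact (card B) * transversal_sum row col (Y B))"
    using transversal_sum_peel_row[OF X(1-3)] by (simp add: Pow_def L_def Y_def)
  also have "\<dots> = (\<Sum>B\<in>Pow L. (-1) ^ card B * fact (card B) * row_recursion r (\<lambda>i. ?a i - card B))"
    using Y by (intro sum.cong) simp_all
  also have "\<dots> = row_recursion (Suc r) ?a"
    using sum_Pow_card[OF \<open>finite L\<close>, of "\<lambda>k. (-1) ^ k * fact k * row_recursion r (\<lambda>i. ?a i - k)"]
    by (simp add: L_def mult.assoc)
  finally show ?case .
qed

section \<open>Tableaux and tabloids\<close>

abbreviation entries :: "nat list \<Rightarrow> nat set" where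
  "entries lam \<equiv> {1..sum_list lam}"

text \<open>The position of an entry is recovered by inverting the tableau on its diagram. Outside
  \<open>entries lam\<close> the value is arbitrary, so all later statements are restricted to
  entries.\<close>

definition tab_row :: "nat list \<Rightarrow> (nat \<times> nat \<Rightarrow> nat) \<Rightarrow> nat \<Rightarrow> nat" where
  "tab_row lam t x = fst (the_inv_into (diagram lam) t x)"

definition tab_col :: "nat list \<Rightarrow> (nat \<times> nat \<Rightarrow> nat) \<Rightarrow> nat \<Rightarrow> nat" where
  "tab_col lam t x = snd (the_inv_into (diagram lam) t x)"

lemma diagram_eq_Sigma: "diagram lam = Sigma {..<length lam} (\<lambda>i. {..<lam ! i})"
  by (auto simp: diagram_def)

lemma finite_diagram: "finite (diagram lam)"
  by (simp add: diagram_eq_Sigma)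

lemma card_diagram: "card (diagram lam) = sum_list lam"
  by (simp add: diagram_eq_Sigma sum_list_sum_nth atLeast0LessThan)

lemma tableau_exists: "\<exists>t. tableau lam t"
  unfolding tableau_def by (rule finite_same_card_bij) (auto simp: finite_diagram card_diagram)

lemma tab_row_col_cell:
  assumes "tableau lam t" "(i, j) \<in> diagram lam"
  shows "t (i, j) \<in> entries lam" "tab_row lam t (t (i, j)) = i" "tab_col lam t (t (i, j)) = j"
  using assms by (auto simp: tableau_def tab_row_def tab_col_def bij_betw_def the_inv_into_f_f)

lemma tab_cell_of_entry:
  assumes "tableau lam t" "x \<in> entries lam"
  shows "(tab_row lam t x, tab_col lam t x) \<in> diagram lam"
    and "t (tab_row lam t x, tab_col lam t x) = x"
  using assms
  by (auto simp: tableau_def tab_row_def tab_col_def bij_betw_def the_inv_into_into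
      f_the_inv_into_f simp del: atLeastAtMost_iff)

lemma inj_on_tab_row_col:
  assumes "tableau lam t"
  shows "inj_on (\<lambda>x. (tab_row lam t x, tab_col lam t x)) (entries lam)"
  by (rule inj_on_inverseI[where g = t]) (rule tab_cell_of_entry[OF assms])

lemma row_entries:
  assumes "tableau lam t" "i < length lam"
  shows "{t (i, j) |j. j < lam ! i} = {x \<in> entries lam. tab_row lam t x = i}"
proof (intro set_eqI iffI)
  fix x assume "x \<in> {t (i, j) |j. j < lam ! i}"
  then obtain j where "x = t (i, j)" "(i, j) \<in> diagram lam" using assms by (auto simp: diagram_def)
  then show "x \<in> {x \<in> entries lam. tab_row lam t x = i}"
    using tab_row_col_cell[OF assms(1)] by simp
next
  fix x assume x: "x \<in> {x \<in> entries lam. tab_row lam t x = i}"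
  then have "(i, tab_col lam t x) \<in> diagram lam" "t (i, tab_col lam t x) = x"
    using tab_cell_of_entry[OF assms(1), of x] by auto
  then show "x \<in> {t (i, j) |j. j < lam ! i}"
    by (force simp: diagram_def)
qed

lemma column_entries:
  assumes "tableau lam t"
  shows "{t (i, j) |i. (i, j) \<in> diagram lam} = {x \<in> entries lam. tab_col lam t x = j}"
proof (intro set_eqI iffI)
  fix x assume "x \<in> {t (i, j) |i. (i, j) \<in> diagram lam}"
  then obtain i where "x = t (i, j)" "(i, j) \<in> diagram lam" by auto
  then show "x \<in> {x \<in> entries lam. tab_col lam t x = j}"
    using tab_row_col_cell[OF assms(1)] by simp
next
  fix x assume x: "x \<in> {x \<in> entries lam. tab_col lam t x = j}"
  then have "(tab_row lam t x, j) \<in> diagram lam" "t (tab_row lam t x, j) = x"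
    using tab_cell_of_entry[OF assms(1), of x] by auto
  then show "x \<in> {t (i, j) |i. (i, j) \<in> diagram lam}" by force
qed

text \<open>A permutation that keeps the column of each entry maps each column injectively into
  itself, hence onto itself because columns are finite.\<close>

lemma column_stabilizer_eq:
  assumes "tableau lam t"
  shows "column_stabilizer lam t = fibre_perms (tab_col lam t) (entries lam)"
proof (intro set_eqI iffI)
  fix p assume "p \<in> column_stabilizer lam t"
  then have p: "p permutes entries lam"
    and im: "\<And>j. p ` {x \<in> entries lam. tab_col lam t x = j} = {x \<in> entries lam. tab_col lam t x = j}"
    by (auto simp: column_stabilizer_def column_entries[OF assms] simp del: atLeastAtMost_iff)
  have "tab_col lam t (p x) = tab_col lam t x" if "x \<in> entries lam" for x
    using im[of "tab_col lam t x"] that by blast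
  with p show "p \<in> fibre_perms (tab_col lam t) (entries lam)"
    by (simp add: fibre_perms_def)
next
  fix p assume "p \<in> fibre_perms (tab_col lam t) (entries lam)"
  then have p: "p permutes entries lam" and c: "\<forall>x\<in>entries lam. tab_col lam t (p x) = tab_col lam t x"
    by (auto simp: fibre_perms_def)
  have "p ` {x \<in> entries lam. tab_col lam t x = j} = {x \<in> entries lam. tab_col lam t x = j}" for j
  proof (rule endo_inj_surj)
    show "p ` {x \<in> entries lam. tab_col lam t x = j} \<subseteq> {x \<in> entries lam. tab_col lam t x = j}"
      using c permutes_in_image[OF p] by blast
  qed (auto intro: permutes_inj_on[OF p])
  with p show "p \<in> column_stabilizer lam t"
    by (simp add: column_stabilizer_def column_entries[OF assms])
qed

lemma tabloid_of_eq_iff: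
  assumes "tableau lam t" "tableau lam u"
  shows "tabloid_of lam t = tabloid_of lam u
    \<longleftrightarrow> (\<forall>x\<in>entries lam. tab_row lam t x = tab_row lam u x)"
proof
  assume eq: "tabloid_of lam t = tabloid_of lam u"
  show "\<forall>x\<in>entries lam. tab_row lam t x = tab_row lam u x"
  proof
    fix x assume x: "x \<in> entries lam"
    let ?i = "tab_row lam t x"
    have i: "?i < length lam"
      using tab_cell_of_entry(1)[OF assms(1) x] by (simp add: diagram_def)
    then have "tabloid_of lam t ! ?i = tabloid_of lam u ! ?i" using eq by simp
    then have "{x \<in> entries lam. tab_row lam t x = ?i} = {x \<in> entries lam. tab_row lam u x = ?i}"
      using i by (simp add: tabloid_of_def row_entries[OF assms(1)] row_entries[OF assms(2)])
    with x show "?i = tab_row lam u x" by (metis (mono_tags, lifting) mem_Collect_eq)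
  qed
next
  assume "\<forall>x\<in>entries lam. tab_row lam t x = tab_row lam u x"
  then show "tabloid_of lam t = tabloid_of lam u"
    by (auto simp: tabloid_of_def row_entries[OF assms(1)] row_entries[OF assms(2)]
        simp del: atLeastAtMost_iff)
qed

lemma tabloid_of_comp: "tabloid_of lam (s \<circ> t) = map ((`) s) (tabloid_of lam t)"
  by (auto simp: tabloid_of_def)

lemma tableau_comp:
  assumes "tableau lam t" "s permutes entries lam"
  shows "tableau lam (s \<circ> t)"
  using assms bij_betw_trans permutes_imp_bij unfolding tableau_def by blast

lemma tab_row_col_comp:
  assumes "tableau lam t" "s permutes entries lam" "x \<in> entries lam"
  shows "tab_row lam (s \<circ> t) (s x) = tab_row lam t x" "tab_col lam (s \<circ> t) (s x) = tab_col lam t x"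
  using tab_row_col_cell(2,3)[OF tableau_comp[OF assms(1,2)] tab_cell_of_entry(1)[OF assms(1,3)]]
    tab_cell_of_entry(2)[OF assms(1,3)] by auto

text \<open>The entry \<open>g x\<close> stands in \<open>g \<circ> t\<close> where \<open>x\<close>
  stands in \<open>t\<close>, so reindexing by \<open>g\<close> turns equality of the tabloids into
  invariance of the row function.\<close>

lemma tabloid_of_comp_eq_iff:
  assumes "tableau lam t" "g permutes entries lam"
  shows "tabloid_of lam t = tabloid_of lam (g \<circ> t) \<longleftrightarrow> g \<in> fibre_perms (tab_row lam t) (entries lam)"
proof -
  have "(\<forall>x\<in>entries lam. tab_row lam t x = tab_row lam (g \<circ> t) x)
     \<longleftrightarrow> (\<forall>x\<in>g ` entries lam. tab_row lam t x = tab_row lam (g \<circ> t) x)"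
    by (simp only: permutes_image[OF assms(2)])
  also have "\<dots> \<longleftrightarrow> (\<forall>x\<in>entries lam. tab_row lam t (g x) = tab_row lam t x)"
    using tab_row_col_comp[OF assms] by simp
  finally show ?thesis
    using assms tabloid_of_eq_iff[OF assms(1) tableau_comp[OF assms]]
    by (simp add: fibre_perms_def)
qed

section \<open>Straightening a tabloid by a column permutation\<close>

lemma diagram_below_column_length:
  assumes lam: "sorted_wrt (\<ge>) lam" and i: "i < card {i. (i, j) \<in> diagram lam}"
  shows "(i, j) \<in> diagram lam"
proof (rule ccontr)
  assume n: "(i, j) \<notin> diagram lam"
  \<comment> \<open>Since rows are weakly decreasing, the first missing cell ends the column, so a
    missing cell in row \<open>i\<close> leaves at most \<open>i\<close> cells.\<close>
  have "i' < i" if "(i', j) \<in> diagram lam" for i'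
  proof (rule ccontr)
    assume "\<not> i' < i"
    with n that have "i < i'" by (cases "i = i'") auto
    then show False
      using that n lam by (fastforce simp: diagram_def sorted_wrt_iff_nth_less)
  qed
  then have "{i. (i, j) \<in> diagram lam} \<subseteq> {..<i}" by auto
  from card_mono[OF _ this] i show False by simp
qed

text \<open>
  If \<open>t\<close> and \<open>u\<close> are in general position, each column of \<open>t\<close> can be sorted by the rows its entries
  occupy in \<open>u\<close>. The row that an entry reaches is at most its row in \<open>u\<close>, and since both
  row functions have the same sum over all entries they coincide.
\<close>

lemma column_straightening:
  assumes lam: "sorted_wrt (\<ge>) lam" and t: "tableau lam t" and u: "tableau lam u"
    and inj: "inj_on (\<lambda>x. (tab_col lam t x, tab_row lam u x)) (entries lam)"
  shows "\<exists>q\<in>column_stabilizer lam t. tabloid_of lam u = tabloid_of lam (q \<circ> t)"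
proof -
  let ?N = "entries lam"
  define col where "col = tab_col lam t"
  define \<rho> where "\<rho> = tab_row lam u"
  \<comment> \<open>The size of \<open>before x\<close> is the rank of \<open>x\<close> when its
    column in \<open>t\<close> is sorted by rows in \<open>u\<close>; it is the row to which
    \<open>x\<close> is to be moved.\<close>
  define before where "before = (\<lambda>x. {y \<in> ?N. col y = col x \<and> \<rho> y < \<rho> x})"
  have before_fin: "finite (before x)" for x by (simp add: before_def)
  have inj': "x = y" if "x \<in> ?N" "y \<in> ?N" "col x = col y" "\<rho> x = \<rho> y" for x y
    using inj that by (auto simp: inj_on_def col_def \<rho>_def)
  have cell: "(card (before x), col x) \<in> diagram lam" if x: "x \<in> ?N" for x
  proof (rule diagram_below_column_length[OF lam])
    \<comment> \<open>The entry \<open>x\<close> lies in its own column but not before itself, so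
      its rank is less than the column length and names a cell.\<close>
    have "before x \<subset> {y \<in> ?N. col y = col x}" using x by (auto simp: before_def)
    then have "card (before x) < card {y \<in> ?N. col y = col x}"
      by (rule psubset_card_mono[rotated]) simp
    also have "{y \<in> ?N. col y = col x} = (\<lambda>i. t (i, col x)) ` {i. (i, col x) \<in> diagram lam}"
      unfolding col_def column_entries[OF t, symmetric] by auto
    also have "card \<dots> \<le> card {i. (i, col x) \<in> diagram lam}"
      by (rule card_image_le) (rule finite_subset[of _ "{..<length lam}"], auto simp: diagram_def)
    finally show "card (before x) < card {i. (i, col x) \<in> diagram lam}" .
  qed
  define w where "w = (\<lambda>x. if x \<in> ?N then t (card (before x), col x) else x)"
  have wN: "w x \<in> ?N" and w_row: "tab_row lam t (w x) = card (before x)"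
    and w_col: "tab_col lam t (w x) = col x" if "x \<in> ?N" for x
    using tab_row_col_cell[OF t cell[OF that]] that by (auto simp: w_def)
  have "inj_on w ?N"
  proof (rule inj_onI)
    fix x y assume xy: "x \<in> ?N" "y \<in> ?N" "w x = w y"
    then have c: "col x = col y" "card (before x) = card (before y)"
      using w_row w_col by metis+
    have "\<not> \<rho> x < \<rho> y" if "x \<in> ?N" "y \<in> ?N" "col x = col y" "card (before x) = card (before y)" for x y
    proof
      assume "\<rho> x < \<rho> y"
      then have "before x \<subset> before y" using that by (auto simp: before_def)
      from psubset_card_mono[OF before_fin this] that show False by simp
    qed
    then have "\<rho> x = \<rho> y" using xy c by (metis linorder_neqE_nat)
    then show "x = y" using inj' xy c by blast
  qed
  moreover from this have "w ` ?N = ?N" using wN by (intro endo_inj_surj) auto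
  ultimately have "w permutes ?N"
    by (intro bij_imp_permutes) (auto simp: bij_betw_def w_def)
  then have w: "w \<in> fibre_perms (tab_col lam t) ?N"
    using w_col by (simp add: fibre_perms_def col_def)
  \<comment> \<open>The sum of the row indices over all entries depends on the shape only.\<close>
  have row_sum: "(\<Sum>x\<in>?N. tab_row lam v x) = (\<Sum>c\<in>diagram lam. fst c)" if "tableau lam v" for v
    using that by (intro sum.reindex_bij_witness[where i = v and j = "\<lambda>x. (tab_row lam v x, tab_col lam v x)"])
      (auto simp del: atLeastAtMost_iff One_nat_def simp: tab_row_col_cell tab_cell_of_entry)
  have "(\<Sum>x\<in>?N. card (before x)) = (\<Sum>x\<in>?N. tab_row lam t (w x))"
    using w_row by simp
  also have "\<dots> = (\<Sum>x\<in>?N. tab_row lam t x)"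
    using sum.permute[OF \<open>w permutes ?N\<close>, of "tab_row lam t"] by simp
  also have "\<dots> = (\<Sum>x\<in>?N. \<rho> x)" using row_sum t u by (simp add: \<rho>_def)
  finally have sums: "(\<Sum>x\<in>?N. card (before x)) = (\<Sum>x\<in>?N. \<rho> x)" .
  have le: "card (before x) \<le> \<rho> x" if "x \<in> ?N" for x
  proof -
    have "inj_on \<rho> (before x)" using inj' by (auto simp: inj_on_def before_def)
    then have "card (before x) = card (\<rho> ` before x)" by (simp add: card_image)
    also have "\<dots> \<le> card {..<\<rho> x}" by (rule card_mono) (auto simp: before_def)
    finally show ?thesis by simp
  qed
  have eq: "tab_row lam t (w x) = tab_row lam u x" if "x \<in> ?N" for x
    using sum_mono_inv[OF sums le that] w_row[OF that] by (simp add: \<rho>_def)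
  \<comment> \<open>An entry \<open>x\<close> stands in \<open>q \<circ> t\<close> where
    \<open>w x\<close> stands in \<open>t\<close>, which by \<open>eq\<close> is in its row in
    \<open>u\<close>.\<close>
  define q where "q = inv w"
  have q: "q permutes ?N" and wq: "w (q x) = x" and qw: "q (w x) = x" for x
    using \<open>w permutes ?N\<close> by (auto simp: q_def permutes_inv permutes_inverses)
  have "tab_col lam t (q x) = tab_col lam t x" if "x \<in> ?N" for x
  proof -
    have "q x \<in> ?N" using that permutes_in_image[OF q] by blast
    from w_col[OF this] show ?thesis by (simp only: wq col_def)
  qed
  then have "q \<in> fibre_perms (tab_col lam t) ?N"
    using q by (simp add: fibre_perms_def)
  moreover have "tabloid_of lam u = tabloid_of lam (q \<circ> t)"
    unfolding tabloid_of_eq_iff[OF u tableau_comp[OF t q]]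
  proof
    fix x assume x: "x \<in> ?N"
    show "tab_row lam u x = tab_row lam (q \<circ> t) x"
      using tab_row_col_comp(1)[OF t q wN[OF x]] eq[OF x] by (simp only: qw)
  qed
  ultimately show ?thesis by (auto simp: column_stabilizer_eq[OF t])
qed

section \<open>Action of the derangements on polytabloids\<close>

lemma finite_column_stabilizer: "finite (column_stabilizer lam t)"
  unfolding column_stabilizer_def by (rule finite_subset[OF _ finite_permutations[of "entries lam"]]) auto

lemma finite_derangements: "finite (derangements n)"
  unfolding derangements_def by (rule finite_subset[OF _ finite_permutations[of "{1..n}"]]) auto

lemma column_stabilizer_permutation:
  assumes "p \<in> column_stabilizer lam t"
  shows "p permutes entries lam" "permutation p"
  using assms permutes_imp_permutation[of "entries lam" p] by (auto simp: column_stabilizer_def)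

text \<open>If some two entries share a column of \<open>t\<close> and a row of \<open>u\<close>,
  their transposition fixes the tabloid of \<open>u\<close> and the signed sum cancels. Otherwise
  that tabloid is \<open>q\<close> applied to the one of \<open>t\<close> for a column permutation
  \<open>q\<close>, which the sum absorbs at the cost of the factor \<open>sign q\<close>.\<close>

lemma column_symmetrizer_tabloid:
  assumes lam: "sorted_wrt (\<ge>) lam" and t: "tableau lam t" and u: "tableau lam u"
  shows "\<exists>c. \<forall>T. (\<Sum>p\<in>column_stabilizer lam t. of_int (sign p) * of_bool (T = tabloid_of lam (p \<circ> u)))
    = c * polytabloid lam t T"
proof (cases "inj_on (\<lambda>x. (tab_col lam t x, tab_row lam u x)) (entries lam)")
  case True
  then obtain q where q: "q \<in> column_stabilizer lam t" and uq: "tabloid_of lam u = tabloid_of lam (q \<circ> t)"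
    using column_straightening[OF lam t u] by blast
  have qq: "q permutes entries lam" "permutation q"
    using column_stabilizer_permutation[OF q] by auto
  note comp = fibre_perms_comp[of _ "tab_col lam t" "entries lam", folded column_stabilizer_eq[OF t]]
  have inv: "inv q \<in> column_stabilizer lam t"
    using q fibre_perms_inv by (simp add: column_stabilizer_eq[OF t])
  have cancel: "p \<circ> q \<circ> inv q = p" "p \<circ> inv q \<circ> q = p" for p
    using permutes_inv_o[OF qq(1)] by (simp_all add: comp_assoc)
  have "(\<Sum>p\<in>column_stabilizer lam t. of_int (sign p) * of_bool (T = tabloid_of lam (p \<circ> u)))
      = of_int (sign q) * polytabloid lam t T" for T
  proof -
    have "(\<Sum>p\<in>column_stabilizer lam t. of_int (sign p) * of_bool (T = tabloid_of lam (p \<circ> u)))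
       = (\<Sum>p\<in>column_stabilizer lam t. of_int (sign (p \<circ> inv q)) *
            of_bool (T = tabloid_of lam (p \<circ> t)) :: complex)"
    proof (rule sum.reindex_bij_witness[where i = "\<lambda>p. p \<circ> inv q" and j = "\<lambda>p. p \<circ> q"])
      fix p assume "p \<in> column_stabilizer lam t"
      have "tabloid_of lam (p \<circ> q \<circ> t) = tabloid_of lam (p \<circ> u)"
        by (metis uq tabloid_of_comp comp_assoc)
      then show "of_int (sign (p \<circ> q \<circ> inv q)) * of_bool (T = tabloid_of lam (p \<circ> q \<circ> t))
          = of_int (sign p) * (of_bool (T = tabloid_of lam (p \<circ> u)) :: complex)"
        by (simp add: cancel)
    qed (use comp q inv cancel in auto)
    also have "\<dots> = of_int (sign q) * polytabloid lam t T"
      unfolding polytabloid_def sum_distrib_left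
      using column_stabilizer_permutation(2) qq(2)
      by (intro sum.cong refl) (simp add: sign_compose permutation_inverse sign_inverse)
    finally show ?thesis .
  qed
  then show ?thesis by blast
next
  case False
  then obtain x y where xy: "x \<in> entries lam" "y \<in> entries lam" "x \<noteq> y"
      "tab_col lam t x = tab_col lam t y" "tab_row lam u x = tab_row lam u y"
    by (auto simp: inj_on_def)
  have "transpose x y \<in> fibre_perms (tab_row lam u) (entries lam)"
    using xy by (intro fibre_perms_transpose)
  then have "tabloid_of lam u = tabloid_of lam (transpose x y \<circ> u)"
    using tabloid_of_comp_eq_iff[OF u] by (simp add: fibre_perms_def)
  then have "tabloid_of lam (p \<circ> transpose x y \<circ> u) = tabloid_of lam (p \<circ> u)" for p
    by (metis tabloid_of_comp comp_assoc)
  then have "(\<Sum>p\<in>column_stabilizer lam t. of_int (sign p) * of_bool (T = tabloid_of lam (p \<circ> u)))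
     = (0 :: complex)" for T
    unfolding column_stabilizer_eq[OF t]
    using xy by (intro sum_sign_eq_0[of _ x y]) auto
  then show ?thesis by (intro exI[of _ 0]) simp
qed

section \<open>The group action on polytabloids and the central sum of derangements\<close>

lemma map_image_inv_eq_iff:
  assumes "bij s"
  shows "map ((`) (inv s)) T = U \<longleftrightarrow> T = map ((`) s) U"
proof -
  have "(`) (inv s) \<circ> (`) s = id" "(`) s \<circ> (`) (inv s) = id"
    using assms by (auto simp: fun_eq_iff image_image bij_is_inj bij_is_surj surj_f_inv_f)
  then show ?thesis by (metis list.map_comp list.map_id)
qed

lemma perm_act_polytabloid_apply:
  assumes "s permutes entries lam"
  shows "perm_act s (polytabloid lam t) T
    = (\<Sum>p\<in>column_stabilizer lam t. of_int (sign p) * of_bool (T = tabloid_of lam (s \<circ> p \<circ> t)))"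
  using map_image_inv_eq_iff[OF permutes_bij[OF assms]]
  by (simp add: perm_act_def polytabloid_def tabloid_of_comp comp_assoc)

lemma column_stabilizer_conj:
  assumes t: "tableau lam t" and s: "s permutes entries lam" and p: "p \<in> column_stabilizer lam t"
  shows "s \<circ> p \<circ> inv s \<in> column_stabilizer lam (s \<circ> t)"
proof -
  have pp: "p permutes entries lam"
    and pc: "\<And>x. x \<in> entries lam \<Longrightarrow> tab_col lam t (p x) = tab_col lam t x"
    using p by (auto simp: column_stabilizer_eq[OF t] fibre_perms_def)
  have "s \<circ> p \<circ> inv s permutes entries lam"
    by (intro permutes_compose permutes_inv s pp)
  moreover have "tab_col lam (s \<circ> t) ((s \<circ> p \<circ> inv s) x) = tab_col lam (s \<circ> t) x"
    if x: "x \<in> entries lam" for x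
  proof -
    define y where "y = inv s x"
    have y: "y \<in> entries lam" "x = s y"
      using x s permutes_in_image[OF permutes_inv[OF s]] by (auto simp: y_def permutes_inverses)
    then have py: "p y \<in> entries lam" using permutes_in_image[OF pp] by blast
    have "tab_col lam (s \<circ> t) (s (p y)) = tab_col lam (s \<circ> t) (s y)"
      using tab_row_col_comp(2)[OF t s py] tab_row_col_comp(2)[OF t s y(1)] pc[OF y(1)] by simp
    moreover have "(s \<circ> p \<circ> inv s) x = s (p y)" by (simp add: y_def)
    ultimately show ?thesis by (simp only: y(2)[symmetric])
  qed
  ultimately show ?thesis
    by (simp add: column_stabilizer_eq[OF tableau_comp[OF t s]] fibre_perms_def)
qed

text \<open>Conjugation by \<open>s\<close> carries the column group of \<open>t\<close> to that of
  \<open>s \<circ> t\<close> and preserves signs, so it matches the two sums term by term.\<close>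

lemma perm_act_polytabloid:
  assumes t: "tableau lam t" and s: "s permutes entries lam"
  shows "perm_act s (polytabloid lam t) = polytabloid lam (s \<circ> t)"
proof
  fix T
  have inv_s: "inv s \<circ> s = id" "s \<circ> inv s = id" using permutes_inv_o[OF s] by auto
  then have cancel: "inv s \<circ> (s \<circ> f) = f" "s \<circ> (inv s \<circ> f) = f" for f :: "'z \<Rightarrow> nat"
    by (simp_all add: comp_assoc[symmetric])
  have perm_s: "permutation s" using s permutes_imp_permutation by blast
  show "perm_act s (polytabloid lam t) T = polytabloid lam (s \<circ> t) T"
    unfolding perm_act_polytabloid_apply[OF s] unfolding polytabloid_def
  proof (rule sum.reindex_bij_witness[where i = "\<lambda>p. inv s \<circ> p \<circ> s" and j = "\<lambda>p. s \<circ> p \<circ> inv s"])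
    fix p assume p: "p \<in> column_stabilizer lam t"
    show "s \<circ> p \<circ> inv s \<in> column_stabilizer lam (s \<circ> t)"
      by (rule column_stabilizer_conj[OF t s p])
    show "inv s \<circ> (s \<circ> p \<circ> inv s) \<circ> s = p"
      using inv_s cancel by (simp add: comp_assoc)
    have "sign (s \<circ> p \<circ> inv s) = sign p"
      using perm_s column_stabilizer_permutation[OF p]
      by (simp add: sign_compose permutation_compose permutation_inverse sign_inverse)
    then show "of_int (sign (s \<circ> p \<circ> inv s)) * of_bool (T = tabloid_of lam (s \<circ> p \<circ> inv s \<circ> (s \<circ> t)))
       = (of_int (sign p) * of_bool (T = tabloid_of lam (s \<circ> p \<circ> t)) :: complex)"
      by (simp add: comp_assoc cancel)
  next
    fix p assume p: "p \<in> column_stabilizer lam (s \<circ> t)"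
    show "inv s \<circ> p \<circ> s \<in> column_stabilizer lam t"
      using column_stabilizer_conj[OF tableau_comp[OF t s] permutes_inv[OF s] p]
      by (simp add: cancel permutes_inv_inv[OF s])
    show "s \<circ> (inv s \<circ> p \<circ> s) \<circ> inv s = p"
      using inv_s cancel by (simp add: comp_assoc)
  qed
qed

text \<open>This closure under conjugation is what makes the sum of all derangements
  central.\<close>

lemma derangement_conj:
  assumes "p permutes {1..n}" "s \<in> derangements n"
  shows "inv p \<circ> s \<circ> p \<in> derangements n"
proof -
  have "s permutes {1..n}" and d: "\<And>x. x \<in> {1..n} \<Longrightarrow> s x \<noteq> x"
    using assms(2) by (auto simp: derangements_def)
  then have "inv p \<circ> s \<circ> p permutes {1..n}"
    using assms(1) by (intro permutes_compose permutes_inv)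
  moreover have "inv p (s (p x)) \<noteq> x" if "x \<in> {1..n}" for x
    using d[of "p x"] that permutes_in_image[OF assms(1)] permutes_inverses(1)[OF assms(1)]
    by metis
  ultimately show ?thesis by (simp add: derangements_def)
qed

text \<open>Centrality in use: with \<open>s' = inv p \<circ> s \<circ> p\<close> one has
  \<open>s \<circ> p = p \<circ> s'\<close>. The column symmetrizer then acts last, on the tabloids
  of \<open>s' \<circ> t\<close>.\<close>

lemma sum_derangements_perm_act_apply:
  "(\<Sum>s\<in>derangements (sum_list lam). perm_act s (polytabloid lam t) T)
    = (\<Sum>s\<in>derangements (sum_list lam). \<Sum>p\<in>column_stabilizer lam t.
        of_int (sign p) * of_bool (T = tabloid_of lam (p \<circ> (s \<circ> t))))"
proof -
  let ?D = "derangements (sum_list lam)" and ?C = "column_stabilizer lam t"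
  have "(\<Sum>s\<in>?D. perm_act s (polytabloid lam t) T)
      = (\<Sum>p\<in>?C. \<Sum>s\<in>?D. of_int (sign p) * of_bool (T = tabloid_of lam (s \<circ> p \<circ> t)))"
    by (subst sum.swap) (simp add: perm_act_polytabloid_apply derangements_def)
  also have "\<dots> = (\<Sum>p\<in>?C. \<Sum>s\<in>?D. of_int (sign p) * of_bool (T = tabloid_of lam (p \<circ> (s \<circ> t))))"
  proof (rule sum.cong[OF refl])
    fix p assume "p \<in> ?C"
    then have p: "p permutes entries lam" by (rule column_stabilizer_permutation)
    then have inv_p: "inv p \<circ> p = id" "p \<circ> inv p = id" using permutes_inv_o by auto
    then have cancel: "inv p \<circ> (p \<circ> f) = f" "p \<circ> (inv p \<circ> f) = f" for f :: "'z \<Rightarrow> nat"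
      by (simp_all add: comp_assoc[symmetric])
    show "(\<Sum>s\<in>?D. of_int (sign p) * of_bool (T = tabloid_of lam (s \<circ> p \<circ> t)))
        = (\<Sum>s\<in>?D. of_int (sign p) * (of_bool (T = tabloid_of lam (p \<circ> (s \<circ> t))) :: complex))"
    proof (rule sum.reindex_bij_witness[where i = "\<lambda>s. p \<circ> s \<circ> inv p" and j = "\<lambda>s. inv p \<circ> s \<circ> p"])
      fix s assume s: "s \<in> ?D"
      show "inv p \<circ> s \<circ> p \<in> ?D" by (rule derangement_conj[OF p s])
      show "p \<circ> s \<circ> inv p \<in> ?D"
        using derangement_conj[OF permutes_inv[OF p] s] by (simp add: permutes_inv_inv[OF p])
    qed (simp_all add: comp_assoc cancel inv_p)
  qed
  also have "\<dots> = (\<Sum>s\<in>?D. \<Sum>p\<in>?C. of_int (sign p) * of_bool (T = tabloid_of lam (p \<circ> (s \<circ> t))))"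
    by (rule sum.swap)
  finally show ?thesis .
qed

section \<open>The coefficient of the tabloid of the tableau itself\<close>

lemma polytabloid_tabloid_of:
  assumes t: "tableau lam t"
  shows "polytabloid lam t (tabloid_of lam t) = 1"
proof -
  \<comment> \<open>A permutation preserving both rows and columns is the identity, because an entry
    is determined by its row and column.\<close>
  have "tabloid_of lam t = tabloid_of lam (p \<circ> t) \<longleftrightarrow> p = id" if p: "p \<in> column_stabilizer lam t" for p
  proof
    assume "tabloid_of lam t = tabloid_of lam (p \<circ> t)"
    then have "p \<in> fibre_perms (\<lambda>x. (tab_row lam t x, tab_col lam t x)) (entries lam)"
      using p tabloid_of_comp_eq_iff[OF t column_stabilizer_permutation(1)[OF p]]
      by (simp add: column_stabilizer_eq[OF t] fibre_perms_def)
    then show "p = id" using fibre_perms_inj_on[OF inj_on_tab_row_col[OF t]] by blast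
  qed simp
  then have "polytabloid lam t (tabloid_of lam t)
      = (\<Sum>p\<in>column_stabilizer lam t. if p = id then 1 else 0)"
    unfolding polytabloid_def by (intro sum.cong refl) auto
  also have "\<dots> = 1"
    using finite_column_stabilizer[of lam t] by (simp add: column_stabilizer_def)
  finally show ?thesis .
qed

text \<open>The tabloid of \<open>p \<circ> (s \<circ> t)\<close> is that of \<open>t\<close>
  exactly when \<open>g = p \<circ> s\<close> is a row permutation. So for fixed \<open>p\<close>
  the sum over \<open>s\<close> becomes a sum over those \<open>g\<close> for which
  \<open>inv p \<circ> g\<close> is a derangement.\<close>

lemma derangement_coefficient:
  assumes t: "tableau lam t"
  shows "(\<Sum>s\<in>derangements (sum_list lam). \<Sum>p\<in>column_stabilizer lam t.
        of_int (sign p) * of_bool (tabloid_of lam t = tabloid_of lam (p \<circ> (s \<circ> t))))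
     = (of_int (\<Sum>p\<in>fibre_perms (tab_col lam t) (entries lam). \<Sum>g\<in>fibre_perms (tab_row lam t) (entries lam).
             sign p * of_bool (\<forall>x\<in>entries lam. \<not> (p x = x \<and> g x = x))) :: complex)"
proof -
  let ?N = "entries lam"
  let ?D = "derangements (sum_list lam)" and ?C = "column_stabilizer lam t"
  let ?R = "fibre_perms (tab_row lam t) ?N"
  have "(\<Sum>s\<in>?D. of_bool (tabloid_of lam t = tabloid_of lam (p \<circ> (s \<circ> t))))
      = (\<Sum>g\<in>?R. of_bool (\<forall>x\<in>?N. \<not> (p x = x \<and> g x = x)) :: complex)" if pC: "p \<in> ?C" for p
  proof -
    have p: "p permutes ?N" using pC by (rule column_stabilizer_permutation)
    have pcol: "\<And>x. x \<in> ?N \<Longrightarrow> tab_col lam t (p x) = tab_col lam t x"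
      using pC by (auto simp: column_stabilizer_eq[OF t] fibre_perms_def)
    have inv_p: "inv p \<circ> p = id" "p \<circ> inv p = id" using p permutes_inv_o by auto
    then have cancel: "inv p \<circ> (p \<circ> f) = f" "p \<circ> (inv p \<circ> f) = f" for f :: "nat \<Rightarrow> nat"
      by (simp_all add: comp_assoc[symmetric])
    have perm: "s permutes ?N" if "s \<in> ?D" for s using that by (simp add: derangements_def)
    have eq: "tabloid_of lam t = tabloid_of lam (p \<circ> (s \<circ> t)) \<longleftrightarrow> p \<circ> s \<in> ?R" if "s \<in> ?D" for s
      using tabloid_of_comp_eq_iff[OF t permutes_compose[OF perm[OF that] p]] by (simp add: comp_assoc)
    \<comment> \<open>If \<open>g x = p x\<close>, this entry shares its row with \<open>x\<close>
      through \<open>g\<close> and its column through \<open>p\<close>, so it is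
      \<open>x\<close>.\<close>
    have iff: "inv p \<circ> g \<in> ?D \<longleftrightarrow> (\<forall>x\<in>?N. \<not> (p x = x \<and> g x = x))" if g: "g \<in> ?R" for g
    proof -
      have gp: "g permutes ?N" and grow: "\<And>x. x \<in> ?N \<Longrightarrow> tab_row lam t (g x) = tab_row lam t x"
        using g by (auto simp: fibre_perms_def)
      have "inv p (g x) = x \<longleftrightarrow> p x = x \<and> g x = x" if x: "x \<in> ?N" for x
      proof
        assume "inv p (g x) = x"
        then have gx: "g x = p x" using permutes_inv_eq[OF p] by metis
        then have "tab_row lam t (p x) = tab_row lam t x" using grow[OF x] by simp
        moreover have "p x \<in> ?N" using x permutes_in_image[OF p] by blast
        ultimately have "p x = x"
          using pcol[OF x] x inj_on_tab_row_col[OF t] by (auto simp: inj_on_def simp del: atLeastAtMost_iff)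
        with gx show "p x = x \<and> g x = x" by simp
      next
        assume "p x = x \<and> g x = x"
        then show "inv p (g x) = x" using permutes_inv_eq[OF p] by metis
      qed
      then show ?thesis
        using permutes_compose[OF gp permutes_inv[OF p]] by (simp add: derangements_def)
    qed
    have "(\<Sum>s\<in>?D. of_bool (tabloid_of lam t = tabloid_of lam (p \<circ> (s \<circ> t))) :: complex)
        = of_nat (card {s \<in> ?D. p \<circ> s \<in> ?R})"
      using eq finite_derangements by (simp add: Int_def cong: conj_cong)
    also have "card {s \<in> ?D. p \<circ> s \<in> ?R} = card {g \<in> ?R. \<forall>x\<in>?N. \<not> (p x = x \<and> g x = x)}"
    proof (rule bij_betw_same_card[OF bij_betw_byWitness[where f = "\<lambda>s. p \<circ> s" and f' = "\<lambda>g. inv p \<circ> g"]])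
      show "(\<circ>) p ` {s \<in> ?D. p \<circ> s \<in> ?R} \<subseteq> {g \<in> ?R. \<forall>x\<in>?N. \<not> (p x = x \<and> g x = x)}"
        using iff[of "p \<circ> s" for s, unfolded cancel] by blast
      show "(\<circ>) (inv p) ` {g \<in> ?R. \<forall>x\<in>?N. \<not> (p x = x \<and> g x = x)} \<subseteq> {s \<in> ?D. p \<circ> s \<in> ?R}"
        using iff cancel(2) by (auto simp del: atLeastAtMost_iff One_nat_def)
    qed (auto simp: cancel)
    also have "of_nat \<dots> = (\<Sum>g\<in>?R. of_bool (\<forall>x\<in>?N. \<not> (p x = x \<and> g x = x)) :: complex)"
      using finite_fibre_perms[of ?N "tab_row lam t"] by (simp add: Int_def)
    finally show ?thesis .
  qed
  then show ?thesis
    unfolding column_stabilizer_eq[OF t]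
    by (subst sum.swap) (simp add: sum_distrib_left[symmetric])
qed

section \<open>Traces on Specht modules\<close>

text \<open>The chosen basis depends on \<open>V\<close> alone, so one basis computes the traces of
  all \<open>F\<close>. It is finite because it is independent in a finitely spanned space.\<close>

lemma trace_on_basis:
  assumes "finite G" "V = cfun.span G"
  obtains B where "finite B" "cfun.independent B" "cfun.span B = V"
    "\<And>F. trace_on V F = (\<Sum>b\<in>B. cfun.representation B (F b) b)"
proof -
  define B where "B = (SOME B. cfun.independent B \<and> cfun.span B = V)"
  have "\<exists>B. cfun.independent B \<and> cfun.span B = V"
    using cfun.maximal_independent_subset[of V] assms(2)
    by (metis cfun.span_span cfun.span_mono subset_antisym)
  then have B: "cfun.independent B \<and> cfun.span B = V"
    unfolding B_def by (rule someI_ex)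
  then have "B \<subseteq> cfun.span G" using assms(2) cfun.span_superset by blast
  then have "finite B" using cfun.independent_span_bound[OF assms(1)] B by blast
  with B show ?thesis using that by (simp add: trace_on_def B_def[symmetric])
qed

lemma sum_trace_on_scalar:
  assumes "finite G" "V = cfun.span G"
    and inV: "\<And>s v. s \<in> D \<Longrightarrow> v \<in> V \<Longrightarrow> F s v \<in> V"
    and scalar: "\<And>v. v \<in> V \<Longrightarrow> (\<Sum>s\<in>D. F s v) = fscale c v"
  shows "(\<Sum>s\<in>D. trace_on V (F s)) = c * trace_on V (\<lambda>v. v)"
proof -
  obtain B where B: "finite B" "cfun.independent B" "cfun.span B = V"
    and tr: "\<And>F. trace_on V F = (\<Sum>b\<in>B. cfun.representation B (F b) b)"
    using trace_on_basis[OF assms(1,2)] by blast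
  have BV: "b \<in> V" if "b \<in> B" for b using that B(3) cfun.span_base by blast
  have "(\<Sum>s\<in>D. trace_on V (F s)) = (\<Sum>b\<in>B. \<Sum>s\<in>D. cfun.representation B (F s b) b)"
    unfolding tr by (rule sum.swap)
  \<comment> \<open>Coordinates are additive only for vectors in the span of \<open>B\<close>, which
    is why each \<open>F s\<close> has to preserve \<open>V\<close>.\<close>
  also have "\<dots> = (\<Sum>b\<in>B. cfun.representation B (\<Sum>s\<in>D. F s b) b)"
    using B BV inV by (intro sum.cong refl) (simp add: cfun.representation_sum)
  also have "\<dots> = (\<Sum>b\<in>B. c * cfun.representation B b b)"
    using B BV by (intro sum.cong refl) (simp add: scalar cfun.representation_scale)
  finally show ?thesis by (simp add: tr sum_distrib_left)
qed

text \<open>This trace is the dimension, and the space contains a nonzero vector.\<close>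

lemma trace_on_ident_neq_0:
  assumes "finite G" "V = cfun.span G" "v \<in> V" "v \<noteq> 0"
  shows "trace_on V (\<lambda>v. v) \<noteq> 0"
proof -
  obtain B where B: "finite B" "cfun.independent B" "cfun.span B = V"
    and tr: "\<And>F. trace_on V F = (\<Sum>b\<in>B. cfun.representation B (F b) b)"
    using trace_on_basis[OF assms(1,2)] by blast
  have "trace_on V (\<lambda>v. v) = of_nat (card B)"
    using B by (simp add: tr cfun.representation_basis)
  moreover have "B \<noteq> {}" using assms B by auto
  ultimately show ?thesis using B(1) by simp
qed

text \<open>Tableaux are arbitrary off the diagram, so there are infinitely many of them as
  functions. A polytabloid depends only on the restriction to the diagram, and finitely many
  restrictions exist.\<close>

lemma finite_polytabloids: "finite {polytabloid lam t |t. tableau lam t}"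
proof (rule finite_subset)
  show "{polytabloid lam t |t. tableau lam t} \<subseteq> polytabloid lam ` (diagram lam \<rightarrow>\<^sub>E entries lam)"
  proof clarify
    fix t assume t: "tableau lam t"
    let ?t = "restrict t (diagram lam)"
    have cell: "(i, j) \<in> diagram lam" if "i < length lam" "j < lam ! i" for i j
      using that by (simp add: diagram_def)
    have "{?t (i, j) |i. (i, j) \<in> diagram lam} = {t (i, j) |i. (i, j) \<in> diagram lam}" for j
      by auto
    then have "column_stabilizer lam ?t = column_stabilizer lam t"
      by (simp only: column_stabilizer_def)
    moreover have "tabloid_of lam (p \<circ> ?t) = tabloid_of lam (p \<circ> t)" for p
      unfolding tabloid_of_def by (rule map_cong) (auto simp: cell)
    ultimately have "polytabloid lam t = polytabloid lam ?t"
      by (simp add: polytabloid_def)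
    moreover have "?t \<in> diagram lam \<rightarrow>\<^sub>E entries lam"
      using t by (auto simp: tableau_def bij_betw_def simp del: atLeastAtMost_iff One_nat_def)
    ultimately show "polytabloid lam t \<in> polytabloid lam ` (diagram lam \<rightarrow>\<^sub>E entries lam)"
      by blast
  qed
  show "finite (polytabloid lam ` (diagram lam \<rightarrow>\<^sub>E entries lam))"
    by (intro finite_imageI finite_PiE finite_diagram) simp
qed

lemma perm_act_add: "perm_act s (f + g) = perm_act s f + perm_act s g"
  by (simp add: perm_act_def fun_eq_iff)

lemma perm_act_fscale: "perm_act s (fscale c f) = fscale c (perm_act s f)"
  by (simp add: perm_act_def fscale_def fun_eq_iff)

lemma perm_act_zero: "perm_act s 0 = 0"
  by (simp add: perm_act_def fun_eq_iff)

lemma perm_act_specht: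
  assumes s: "s permutes entries lam" and "v \<in> specht lam"
  shows "perm_act s v \<in> specht lam"
  using assms(2) unfolding specht_def
proof (induction rule: cfun.span_induct_alt)
  case base
  show ?case unfolding perm_act_zero by (rule cfun.span_zero)
next
  case (step c x y)
  then have "perm_act s x \<in> {polytabloid lam t |t. tableau lam t}"
    using perm_act_polytabloid[OF _ s] tableau_comp[OF _ s] by auto
  with step.IH show ?case
    unfolding perm_act_add perm_act_fscale
    by (intro cfun.span_add cfun.span_scale) (auto intro: cfun.span_base)
qed

section \<open>The eigenvalues and their recurrence\<close>

text \<open>An integer formula for the scalar by which the derangements act; the sign comes from
  complementing in the inclusion-exclusion.\<close>

definition eigenvalue_of :: "nat list \<Rightarrow> int" where
  "eigenvalue_of lam = (-1) ^ sum_list lam * row_recursion (length lam) ((!) lam)"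

lemma transversal_sum_tableau:
  assumes lam: "sorted_wrt (\<ge>) lam" and t: "tableau lam t"
  shows "transversal_sum (tab_row lam t) (tab_col lam t) (entries lam)
    = row_recursion (length lam) ((!) lam)"
proof -
  have "transversal_sum (tab_row lam t) (tab_col lam t) (entries lam)
      = row_recursion (length lam) (\<lambda>i. card {x \<in> entries lam. tab_row lam t x = i})"
  proof (rule transversal_sum_eq_row_recursion)
    show "tab_row lam t ` entries lam \<subseteq> {..<length lam}"
      using tab_cell_of_entry(1)[OF t] by (force simp: diagram_def)
    fix i x assume x: "x \<in> entries lam" "i < tab_row lam t x"
    have "(tab_row lam t x, tab_col lam t x) \<in> diagram lam"
      using tab_cell_of_entry(1)[OF t x(1)] .
    with x(2) lam have "(i, tab_col lam t x) \<in> diagram lam"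
      by (fastforce simp: diagram_def sorted_wrt_iff_nth_less)
    from tab_row_col_cell[OF t this]
    show "\<exists>y\<in>entries lam. tab_row lam t y = i \<and> tab_col lam t y = tab_col lam t x" by blast
  qed (use inj_on_tab_row_col[OF t] in auto)
  also have "\<dots> = row_recursion (length lam) ((!) lam)"
  proof (rule row_recursion_cong)
    fix i assume i: "i < length lam"
    have "inj_on (\<lambda>j. t (i, j)) {..<lam ! i}"
      using t i by (auto simp: inj_on_def tableau_def bij_betw_def diagram_def)
    moreover have "{x \<in> entries lam. tab_row lam t x = i} = (\<lambda>j. t (i, j)) ` {..<lam ! i}"
      unfolding row_entries[OF t i, symmetric] by auto
    ultimately show "card {x \<in> entries lam. tab_row lam t x = i} = lam ! i"
      by (simp add: card_image)
  qed
  finally show ?thesis .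
qed

text \<open>Each derangement contributes a column-symmetrized tabloid, hence a multiple of the
  polytabloid. The total multiple is read off at the tabloid of \<open>t\<close>, where the
  polytabloid has coefficient 1.\<close>

lemma sum_derangements_polytabloid:
  assumes lam: "sorted_wrt (\<ge>) lam" and t: "tableau lam t"
  shows "(\<Sum>s\<in>derangements (sum_list lam). perm_act s (polytabloid lam t) T)
    = of_int (eigenvalue_of lam) * polytabloid lam t T"
proof -
  let ?D = "derangements (sum_list lam)" and ?C = "column_stabilizer lam t"
  let ?K = "\<lambda>s T. \<Sum>p\<in>?C. of_int (sign p) * of_bool (T = tabloid_of lam (p \<circ> (s \<circ> t))) :: complex"
  have "\<forall>s\<in>?D. \<exists>c. \<forall>T. ?K s T = c * polytabloid lam t T"
    using column_symmetrizer_tabloid[OF lam t tableau_comp[OF t]] by (auto simp: derangements_def)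
  from bchoice[OF this] obtain c where c: "\<forall>s\<in>?D. \<forall>T. ?K s T = c s * polytabloid lam t T" ..
  have K: "(\<Sum>s\<in>?D. ?K s T) = (\<Sum>s\<in>?D. c s) * polytabloid lam t T" for T
    unfolding sum_distrib_right using c by (intro sum.cong refl) blast
  have "(\<Sum>s\<in>?D. c s) = (\<Sum>s\<in>?D. ?K s (tabloid_of lam t))"
    by (simp only: K polytabloid_tabloid_of[OF t]) simp
  also have "\<dots> = of_int ((-1) ^ card (entries lam) *
      transversal_sum (tab_row lam t) (tab_col lam t) (entries lam))"
    by (simp only: derangement_coefficient[OF t] signed_sum_no_common_fixpoint[OF finite_atLeastAtMost])
  also have "\<dots> = of_int (eigenvalue_of lam)"
    by (simp only: transversal_sum_tableau[OF lam t] eigenvalue_of_def card_atLeastAtMost) simp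
  finally show ?thesis by (simp only: sum_derangements_perm_act_apply K)
qed

text \<open>Both sides are linear in \<open>v\<close>, so the polytabloids, which span,
  decide.\<close>

lemma sum_derangements_specht:
  assumes lam: "sorted_wrt (\<ge>) lam" and "v \<in> specht lam"
  shows "(\<Sum>s\<in>derangements (sum_list lam). perm_act s v) = fscale (of_int (eigenvalue_of lam)) v"
proof -
  have sum_apply: "(\<Sum>s\<in>A. f s) T = (\<Sum>s\<in>A. f s T)" for A and f :: "(nat \<Rightarrow> nat) \<Rightarrow> tabloid \<Rightarrow> complex" and T
    by (induction A rule: infinite_finite_induct) auto
  show ?thesis
    using assms(2) unfolding specht_def
  proof (induction rule: cfun.span_induct_alt)
    case base
    show ?case by (simp only: perm_act_zero sum.neutral_const cfun.scale_zero_right)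
  next
    case (step c x y)
    then obtain t where t: "x = polytabloid lam t" "tableau lam t" by blast
    have "(\<Sum>s\<in>derangements (sum_list lam). perm_act s x) = fscale (of_int (eigenvalue_of lam)) x"
      using sum_derangements_polytabloid[OF lam t(2)] by (simp add: t(1) fun_eq_iff sum_apply fscale_def)
    with step.IH show ?case
      by (simp only: perm_act_add perm_act_fscale sum.distrib cfun.scale_sum_right[symmetric]
          cfun.scale_right_distrib cfun.scale_left_commute)
  qed
qed

text \<open>Taking traces of the scalar action gives the scalar times the dimension, and the
  dimension is the nonzero character value at \<open>id\<close>.\<close>

lemma derangement_eigenvalue_eq:
  assumes lam: "sorted_wrt (\<ge>) lam"
  shows "derangement_eigenvalue lam = of_int (eigenvalue_of lam)"
proof -
  let ?V = "specht lam"
  obtain t where t: "tableau lam t" using tableau_exists by blast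
  have "polytabloid lam t \<in> ?V" using t unfolding specht_def by (intro cfun.span_base) blast
  moreover have "polytabloid lam t \<noteq> 0"
    using polytabloid_tabloid_of[OF t] zero_fun_apply zero_neq_one by metis
  ultimately have "trace_on ?V (\<lambda>v. v) \<noteq> 0"
    using trace_on_ident_neq_0[OF finite_polytabloids specht_def] by blast
  moreover have "irr_char lam id = trace_on ?V (\<lambda>v. v)"
    by (simp add: irr_char_def perm_act_def[abs_def])
  moreover have "(\<Sum>s\<in>derangements (sum_list lam). irr_char lam s)
      = of_int (eigenvalue_of lam) * trace_on ?V (\<lambda>v. v)"
    unfolding irr_char_def
    using perm_act_specht sum_derangements_specht[OF lam]
    by (intro sum_trace_on_scalar[OF finite_polytabloids specht_def]) (auto simp: derangements_def)
  ultimately show ?thesis by (simp add: derangement_eigenvalue_def)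
qed

text \<open>Zero rows stand at the end of a decreasing list, and a last row of length zero admits
  only \<open>k = 0\<close>, with weight 1. This accounts for the parts discarded when a column is
  deleted.\<close>

lemma row_recursion_filter:
  assumes "sorted_wrt (\<ge>) xs"
  shows "row_recursion (length (filter (\<lambda>x. x \<noteq> 0) xs)) ((!) (filter (\<lambda>x. x \<noteq> 0) xs))
    = row_recursion (length xs) ((!) xs)"
  using assms
proof (induction xs rule: rev_induct)
  case (snoc x xs)
  show ?case
  proof (cases "x = 0")
    case True
    have "row_recursion (length xs) ((!) (xs @ [0])) = row_recursion (length xs) ((!) xs)"
      by (rule row_recursion_cong) (simp add: nth_append)
    with True snoc show ?thesis by (simp add: sorted_wrt_append)
  next
    case False
    then have "filter (\<lambda>x. x \<noteq> 0) (xs @ [x]) = xs @ [x]"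
      using snoc.prems by (force simp: sorted_wrt_append filter_id_conv)
    then show ?thesis by simp
  qed
qed simp

lemma sum_list_remove_column:
  assumes "\<forall>x\<in>set lam. 1 \<le> x"
  shows "sum_list (remove_column lam) + length lam = sum_list lam"
  using assms by (induction lam) (auto simp: remove_column_def)

lemma sorted_remove_column:
  assumes "sorted_wrt (\<ge>) lam"
  shows "sorted_wrt (\<ge>) (map (\<lambda>x. x - 1) lam)" "sorted_wrt (\<ge>) (remove_column lam)"
proof -
  show "sorted_wrt (\<ge>) (map (\<lambda>x. x - 1) lam)"
    unfolding sorted_wrt_map by (rule sorted_wrt_mono_rel[OF _ assms]) auto
  then show "sorted_wrt (\<ge>) (remove_column lam)"
    unfolding remove_column_def by (rule sorted_wrt_filter)
qed

theorem theorem1p4: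
  fixes n r :: nat and lam :: "nat list"
  assumes "n \<ge> 1" and "partition_of lam n" and "length lam = r"
  shows "derangement_eigenvalue lam =
           (- 1) ^ (r - 1) * of_nat (lam ! (r - 1)) * derangement_eigenvalue (remove_column lam)
           + (- 1) ^ (lam ! (r - 1)) * derangement_eigenvalue (remove_row lam)
         \<and> derangement_eigenvalue [] = 1"
proof
  have lam: "sorted_wrt (\<ge>) lam" "\<forall>x\<in>set lam. 1 \<le> x" "sum_list lam = n"
    using assms(2) by (auto simp: partition_of_def)
  define mu m where "mu = butlast lam" and "m = last lam"
  have "lam \<noteq> []" using lam(3) assms(1) by auto
  then have mu: "lam = mu @ [m]" by (simp add: mu_def m_def)
  then have r: "r = Suc (length mu)" and m: "lam ! (r - 1) = m" using assms(3) by auto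
  have sorted: "sorted_wrt (\<ge>) mu" using lam(1) mu by (simp add: sorted_wrt_append)
  \<comment> \<open>\<open>E1\<close> and \<open>E2\<close> are the unsigned values for the shape
    without its last row and without its first column; in \<open>E2\<close> the parts that became
    zero are still present.\<close>
  define E1 E2 where "E1 = row_recursion (length mu) ((!) mu)"
    and "E2 = row_recursion r (\<lambda>i. lam ! i - 1)"
  have "row_recursion (length mu) ((!) lam) = E1"
    unfolding E1_def by (rule row_recursion_cong) (simp add: mu nth_append)
  then have "row_recursion r ((!) lam) = E1 - int m * E2"
    using row_recursion_column_row[of "length mu" "(!) lam"] m by (simp only: r E2_def) simp
  then have eig: "eigenvalue_of lam = (-1) ^ n * (E1 - int m * E2)"
    using lam(3) assms(3) by (simp add: eigenvalue_of_def)
  have "row_recursion r ((!) (map (\<lambda>x. x - 1) lam)) = E2"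
    unfolding E2_def by (rule row_recursion_cong) (simp add: assms(3))
  then have eig_col: "eigenvalue_of (remove_column lam) = (-1) ^ sum_list (remove_column lam) * E2"
    using row_recursion_filter[OF sorted_remove_column(1)[OF lam(1)]] assms(3)
    by (simp add: eigenvalue_of_def remove_column_def)
  have eig_row: "eigenvalue_of mu = (-1) ^ sum_list mu * E1"
    by (simp add: eigenvalue_of_def E1_def)
  have "n = sum_list (remove_column lam) + Suc (length mu)"
    using sum_list_remove_column[OF lam(2)] lam(3) assms(3) r by simp
  \<comment> \<open>Deleting the column removes \<open>r\<close> cells. The surplus of
    \<open>r\<close> over \<open>r - 1\<close> supplies the minus sign that cancels the one in
    \<open>row_recursion_column_row\<close>.\<close>
  then have sign_col: "(-1) ^ n = - ((-1) ^ (r - 1) * (-1) ^ sum_list (remove_column lam) :: int)"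
    using r by (simp add: power_add)
  have "n = m + sum_list mu" using lam(3) mu by simp
  then have sign_row: "(-1) ^ n = ((-1) ^ m * (-1) ^ sum_list mu :: int)"
    by (simp add: power_add)
  have "eigenvalue_of lam = (-1) ^ n * E1 - (-1) ^ n * int m * E2"
    by (simp add: eig algebra_simps)
  also have "(-1) ^ n * E1 = (-1) ^ m * eigenvalue_of mu"
    by (simp only: sign_row eig_row mult.assoc)
  also have "(-1) ^ n * int m * E2 = - ((-1) ^ (r - 1) * int m * eigenvalue_of (remove_column lam))"
    by (simp only: sign_col eig_col) (simp add: mult_ac)
  finally have "eigenvalue_of lam = (-1) ^ (r - 1) * int m * eigenvalue_of (remove_column lam)
      + (-1) ^ m * eigenvalue_of mu"
    by simp
  then have "(of_int (eigenvalue_of lam) :: complex)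
      = of_int ((-1) ^ (r - 1) * int m * eigenvalue_of (remove_column lam) + (-1) ^ m * eigenvalue_of mu)"
    by (simp only:)
  then show "derangement_eigenvalue lam =
           (- 1) ^ (r - 1) * of_nat (lam ! (r - 1)) * derangement_eigenvalue (remove_column lam)
           + (- 1) ^ (lam ! (r - 1)) * derangement_eigenvalue (remove_row lam)"
    unfolding m remove_row_def mu_def[symmetric]
    by (simp add: derangement_eigenvalue_eq lam(1) sorted sorted_remove_column)
  show "derangement_eigenvalue [] = 1"
    by (simp add: derangement_eigenvalue_eq eigenvalue_of_def)
qed

end
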